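(* Let $G=(V,E,s)$ be a sandpile graph. A configuration $c$ on $G$ is superstable if and only if $c_{\max}-c$ is recurrent.
   Context: A directed multigraph $G=(V,E)$ has a finite vertex set $V$ and edge set $E\subseteq V\times V$ with a weight function $\mathrm{wt}:V\times V\to\mathbb{N}$, $\mathrm{wt}(u,v)>0$ iff $(u,v)\in E$ (loops allowed); $\mathrm{outdeg}(v)=\sum_{u\in V}\mathrm{wt}(v,u)$. A sandpile graph $(V,E,s)$ is a directed multigraph with a vertex $s$ (the sink) that is globally accessible: from every vertex there is a directed path to $s$. Write $\widetilde V=V\setminus\{s\}$. The reduced Laplacian is $\widetilde\Delta:\mathbb{Z}\widetilde V\to\mathbb{Z}\widetilde V$, $\widetilde\Delta(v)=\mathrm{outdeg}(v)\,v-\sum_{u\in\widetilde V}\mathrm{wt}(v,u)\,u$. A configuration is an element $c=\sum_{v\in\widetilde V}c_v v\in\mathbb{Z}\widetilde V$; it is nonnegative ($c\ge0$) if all $c_v\ge 0$, and stable if $c_v<\mathrm{outdeg}(v)$ for all $v\in\widetilde V$. Firing $v\in\widetilde V$ replaces $c$ by $c-\widetilde\Delta v$ and is legal if $c_v\ge\mathrm{outdeg}(v)$. Write $c\to\tilde c$ if $\tilde c$ is obtained from $c$ by a finite (possibly empty) sequence of legal firings. A configuration $c$ is recurrent if it is nonnegative, stable, and accessible, where accessible means: for every configuration $a$ there is a nonnegative configuration $b$ with $a+b\to c$. The maximal stable configuration is $c_{\max}=\sum_{v\in\widetilde V}(\mathrm{outdeg}(v)-1)\,v$. A configuration $c$ is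 superstable if $c\ge 0$ and there is no nonzero $\sigma\in\mathbb{N}\widetilde V$ with $c-\widetilde\Delta\sigma\ge0$. *)

theory Defs
  imports "HOL-Library.Poly_Mapping"
begin

locale directed_multigraph =
  fixes V :: "'v set" and E :: "('v \<times> 'v) set" and wt :: "'v \<Rightarrow> 'v \<Rightarrow> nat"
  assumes finite_V: "finite V"
    and E_subset: "E \<subseteq> V \<times> V"
    and wt_pos_iff: "u \<in> V \<Longrightarrow> v \<in> V \<Longrightarrow> wt u v > 0 \<longleftrightarrow> (u, v) \<in> E"
begin

(* Loops at v contribute to the out-degree. *)
definition outdeg :: "'v \<Rightarrow> nat" where
  "outdeg v = (\<Sum>u\<in>V. wt v u)"

end

locale sandpile_graph = directed_multigraph V E wt
  for V :: "'v set" and E :: "('v \<times> 'v) set" and wt :: "'v \<Rightarrow> 'v \<Rightarrow> nat" +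
  fixes s :: 'v
  assumes sink_in_V: "s \<in> V"
    and sink_accessible: "v \<in> V \<Longrightarrow> (v, s) \<in> E\<^sup>*"
begin

definition nonsink :: "'v set" where
  "nonsink = V - {s}"

(* The free abelian group on the non-sink vertices, as the subgroup of the free abelian
   group on the whole type 'v consisting of the elements supported on nonsink.
   The predicates on configurations below are meant for elements of this set. *)
definition configs :: "('v \<Rightarrow>\<^sub>0 int) set" where
  "configs = {c. Poly_Mapping.keys c \<subseteq> nonsink}"

definition reduced_laplacian :: "('v \<Rightarrow>\<^sub>0 int) \<Rightarrow> ('v \<Rightarrow>\<^sub>0 int)" where
  "reduced_laplacian = frag_extend (\<lambda>v.
     frag_cmul (int (outdeg v)) (frag_of v)
     - (\<Sum>u\<in>nonsink. frag_cmul (int (wt v u)) (frag_of u)))"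

definition nonneg :: "('v \<Rightarrow>\<^sub>0 int) \<Rightarrow> bool" where
  "nonneg c \<longleftrightarrow> (\<forall>v\<in>nonsink. 0 \<le> Poly_Mapping.lookup c v)"

definition stable :: "('v \<Rightarrow>\<^sub>0 int) \<Rightarrow> bool" where
  "stable c \<longleftrightarrow> (\<forall>v\<in>nonsink. Poly_Mapping.lookup c v < int (outdeg v))"

definition legal_firing :: "('v \<Rightarrow>\<^sub>0 int) \<Rightarrow> ('v \<Rightarrow>\<^sub>0 int) \<Rightarrow> bool" where
  "legal_firing c c' \<longleftrightarrow>
     (\<exists>v\<in>nonsink. int (outdeg v) \<le> Poly_Mapping.lookup c v
        \<and> c' = c - reduced_laplacian (frag_of v))"

definition leads_to :: "('v \<Rightarrow>\<^sub>0 int) \<Rightarrow> ('v \<Rightarrow>\<^sub>0 int) \<Rightarrow> bool" where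
  "leads_to = legal_firing\<^sup>*\<^sup>*"

definition accessible :: "('v \<Rightarrow>\<^sub>0 int) \<Rightarrow> bool" where
  "accessible c \<longleftrightarrow> (\<forall>a\<in>configs. \<exists>b\<in>configs. nonneg b \<and> leads_to (a + b) c)"

definition recurrent :: "('v \<Rightarrow>\<^sub>0 int) \<Rightarrow> bool" where
  "recurrent c \<longleftrightarrow> nonneg c \<and> stable c \<and> accessible c"

definition c_max :: "'v \<Rightarrow>\<^sub>0 int" where
  "c_max = (\<Sum>v\<in>nonsink. frag_cmul (int (outdeg v) - 1) (frag_of v))"

definition superstable :: "('v \<Rightarrow>\<^sub>0 int) \<Rightarrow> bool" where
  "superstable c \<longleftrightarrow> nonneg c \<and>
     \<not> (\<exists>\<sigma>\<in>configs. nonneg \<sigma> \<and> \<sigma> \<noteq> 0 \<and> nonneg (c - reduced_laplacian \<sigma>))"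

end

end

theory Submission
  imports Defs
begin

text \<open>
  Write \<open>c'\<close> for \<open>c_max - c\<close> and \<open>L\<close> for the reduced Laplacian.  For every script \<open>\<sigma>\<close> the
  configuration \<open>c - L \<sigma>\<close> is nonnegative exactly when \<open>c' + L \<sigma>\<close> is stable.  So \<open>c\<close> is superstable
  precisely when \<open>c'\<close> is stable and no nonzero \<open>\<sigma> \<ge> 0\<close> makes \<open>c' + L \<sigma>\<close> stable, and the theorem
  says that this describes the recurrent configurations.

  If \<open>c\<close> is superstable, then \<open>c' + L \<tau>\<close> leads to \<open>c'\<close> for every script \<open>\<tau> \<ge> 0\<close>: unless \<open>\<tau> = 0\<close>,
  some vertex is unstable; it must occur in \<open>\<tau>\<close>, since unfiring other vertices only removes
  grains from it; so firing it uses up one unit of \<open>\<tau>\<close>.  As \<open>L \<tau>\<close> can be made to dominate any given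
  configuration, \<open>c'\<close> is accessible.

  Conversely let \<open>c'\<close> be recurrent and suppose that \<open>c' + L \<sigma>\<close> is stable with \<open>\<sigma> \<ge> 0\<close>.  Accessibility
  gives a legal sequence to \<open>c'\<close>, with script \<open>\<tau>\<close>, from some configuration \<open>x \<ge> c_max + L \<sigma>\<close>.  Then
  \<open>L (\<tau> - \<sigma>) \<ge> 0\<close>, whence \<open>\<tau> - \<sigma> \<ge> 0\<close>.  The script \<open>\<tau> - \<sigma>\<close> also takes \<open>x\<close> to a stable
  configuration, so by the least action principle it is at least \<open>\<tau>\<close>, and \<open>\<sigma> = 0\<close>.

  The global accessibility of the sink enters through a weight \<open>w \<ge> 0\<close> on the vertices which
  every firing decreases by at least one.  It yields both facts about \<open>L\<close> that are used above: the
  implication from \<open>L \<rho> \<ge> 0\<close> to \<open>\<rho> \<ge> 0\<close>, and the existence of \<open>\<tau> \<ge> 0\<close> with \<open>L \<tau>\<close> arbitrarily large.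
\<close>

context sandpile_graph
begin

section \<open>The reduced Laplacian in coordinates\<close>

lemma finite_nonsink: "finite nonsink"
  using finite_V by (simp add: nonsink_def)

lemma configs_iff: "c \<in> configs \<longleftrightarrow> (\<forall>v. v \<notin> nonsink \<longrightarrow> Poly_Mapping.lookup c v = 0)"
  by (auto simp: configs_def in_keys_iff)

lemma configs_add: "a \<in> configs \<Longrightarrow> b \<in> configs \<Longrightarrow> a + b \<in> configs"
  and configs_diff: "a \<in> configs \<Longrightarrow> b \<in> configs \<Longrightarrow> a - b \<in> configs"
  and configs_frag_of: "v \<in> nonsink \<Longrightarrow> frag_of v \<in> configs"
  and configs_0: "0 \<in> configs"
  by (auto simp: configs_iff lookup_add lookup_minus frag_of_nonzero)

lemma configs_eq_0_iff:
  "c \<in> configs \<Longrightarrow> c = 0 \<longleftrightarrow> (\<forall>v\<in>nonsink. Poly_Mapping.lookup c v = 0)"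
  by (auto simp: configs_iff intro!: poly_mapping_eqI)

lemma lookup_sum_frag_of:
  "Poly_Mapping.lookup (\<Sum>u\<in>nonsink. frag_cmul (f u) (frag_of u)) v = (if v \<in> nonsink then f v else 0)"
proof -
  have "Poly_Mapping.lookup (\<Sum>u\<in>nonsink. frag_cmul (f u) (frag_of u)) v
      = (\<Sum>u\<in>nonsink. if u = v then f u else 0)"
    unfolding lookup_sum by (rule sum.cong) auto
  then show ?thesis by (simp add: finite_nonsink)
qed

lemma configs_sum_frag_of: "(\<Sum>u\<in>nonsink. frag_cmul (f u) (frag_of u)) \<in> configs"
  by (simp add: configs_iff lookup_sum_frag_of)

lemma lookup_c_max: "v \<in> nonsink \<Longrightarrow> Poly_Mapping.lookup c_max v = int (outdeg v) - 1"
  by (simp add: c_max_def lookup_sum_frag_of)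

lemma configs_c_max: "c_max \<in> configs"
  by (simp add: c_max_def configs_sum_frag_of)

lemma reduced_laplacian_diff:
  "reduced_laplacian (x - y) = reduced_laplacian x - reduced_laplacian y"
  by (simp add: reduced_laplacian_def frag_extend_diff)

lemma reduced_laplacian_add:
  "reduced_laplacian (x + y) = reduced_laplacian x + reduced_laplacian y"
  by (simp add: reduced_laplacian_def frag_extend_add)

lemma reduced_laplacian_0: "reduced_laplacian 0 = 0"
  by (simp add: reduced_laplacian_def)

lemma lookup_reduced_laplacian:
  assumes "\<sigma> \<in> configs"
  shows "Poly_Mapping.lookup (reduced_laplacian \<sigma>) u =
    (if u \<in> nonsink
     then int (outdeg u) * Poly_Mapping.lookup \<sigma> u
       - (\<Sum>v\<in>nonsink. Poly_Mapping.lookup \<sigma> v * int (wt v u))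
     else 0)"
proof -
  let ?l = "Poly_Mapping.lookup"
  have keys: "Poly_Mapping.keys \<sigma> \<subseteq> nonsink"
    using assms by (simp add: configs_def)
  have "?l (reduced_laplacian \<sigma>) u = (\<Sum>v\<in>Poly_Mapping.keys \<sigma>. ?l \<sigma> v *
      (int (outdeg v) * (if u = v then 1 else 0) - (if u \<in> nonsink then int (wt v u) else 0)))"
    unfolding reduced_laplacian_def frag_extend_def lookup_sum
    by (rule sum.cong) (auto simp: lookup_minus lookup_sum_frag_of)
  also have "\<dots> = (\<Sum>v\<in>nonsink. ?l \<sigma> v *
      (int (outdeg v) * (if u = v then 1 else 0) - (if u \<in> nonsink then int (wt v u) else 0)))"
    by (rule sum.mono_neutral_left) (use keys finite_nonsink in \<open>auto simp: in_keys_iff\<close>)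
  also have "\<dots> = (\<Sum>v\<in>nonsink. if u = v then ?l \<sigma> v * int (outdeg v) else 0)
      - (\<Sum>v\<in>nonsink. ?l \<sigma> v * (if u \<in> nonsink then int (wt v u) else 0))"
    unfolding sum_subtractf[symmetric] by (rule sum.cong) (auto simp: algebra_simps)
  also have "\<dots> = (if u \<in> nonsink then int (outdeg u) * ?l \<sigma> u
       - (\<Sum>v\<in>nonsink. ?l \<sigma> v * int (wt v u)) else 0)"
    by (simp add: finite_nonsink)
  finally show ?thesis .
qed

lemma configs_reduced_laplacian: "\<sigma> \<in> configs \<Longrightarrow> reduced_laplacian \<sigma> \<in> configs"
  by (subst configs_iff) (simp add: lookup_reduced_laplacian)

text \<open>
  A vertex that does not fire can only gain grains.  This is the one property of the signs of the
  Laplacian on which both the greedy firing argument and the least action principle rest.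
\<close>

lemma reduced_laplacian_nonpos_at_unfired:
  assumes "\<rho> \<in> configs" "nonneg \<rho>" "v \<in> nonsink" "Poly_Mapping.lookup \<rho> v = 0"
  shows "Poly_Mapping.lookup (reduced_laplacian \<rho>) v \<le> 0"
proof -
  have "0 \<le> (\<Sum>u\<in>nonsink. Poly_Mapping.lookup \<rho> u * int (wt u v))"
    using assms(2) by (intro sum_nonneg) (auto simp: nonneg_def)
  then show ?thesis using assms by (simp add: lookup_reduced_laplacian)
qed

text \<open>
  The chosen vertex holds at least its out-degree, so it stays nonnegative even if it has no loops.
\<close>

lemma nonneg_fire:
  assumes "nonneg x" "v \<in> nonsink" "int (outdeg v) \<le> Poly_Mapping.lookup x v"
  shows "nonneg (x - reduced_laplacian (frag_of v))"
  unfolding nonneg_def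
proof
  fix u assume u: "u \<in> nonsink"
  show "0 \<le> Poly_Mapping.lookup (x - reduced_laplacian (frag_of v)) u"
  proof (cases "u = v")
    case True
    have "0 \<le> (\<Sum>u\<in>nonsink. Poly_Mapping.lookup (frag_of v) u * int (wt u v))"
      by (intro sum_nonneg) auto
    then show ?thesis
      using True assms by (simp add: lookup_minus lookup_reduced_laplacian configs_frag_of)
  next
    case False
    have "nonneg (frag_of v)" by (auto simp: nonneg_def)
    then have "Poly_Mapping.lookup (reduced_laplacian (frag_of v)) u \<le> 0"
      using False u assms(2)
      by (intro reduced_laplacian_nonpos_at_unfired) (auto simp: configs_frag_of)
    then show ?thesis using assms(1) u by (auto simp: nonneg_def lookup_minus)
  qed
qed

text \<open>Superstability and stability are exchanged by the duality \<open>c \<mapsto> c_max - c\<close>.\<close>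

lemma stable_iff_nonneg_dual: "stable (c_max - c) \<longleftrightarrow> nonneg c"
  by (auto simp: stable_def nonneg_def lookup_minus lookup_c_max)

section \<open>A weight that decreases under firing\<close>

text \<open>
  Let \<open>d v\<close> be the distance from \<open>v\<close> to the sink.  The weight is \<open>D^n - D^(n - d v)\<close>, an
  increasing and steeply concave function of the distance.  Every \<open>v \<noteq> s\<close> sends at least one grain
  to a vertex with smaller distance; for \<open>D\<close> larger than all out-degrees, the weight lost by that
  grain exceeds all that the other grains can gain.
\<close>

lemma decreasing_weight:
  obtains w :: "'v \<Rightarrow> int" where "\<And>v. v \<in> V \<Longrightarrow> 0 \<le> w v"
    "\<And>v. v \<in> nonsink \<Longrightarrow> (\<Sum>u\<in>nonsink. w u * int (wt v u)) + 1 \<le> int (outdeg v) * w v"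
proof -
  define d where "d v = (LEAST n. (v, s) \<in> E ^^ n)" for v
  have d: "(v, s) \<in> E ^^ d v" if "v \<in> V" for v
    unfolding d_def by (rule LeastI_ex) (use sink_accessible[OF that] rtrancl_power in blast)
  have d_le: "d v \<le> n" if "(v, s) \<in> E ^^ n" for v n
    unfolding d_def using that by (rule Least_le)
  have step: "\<exists>u\<in>V. 0 < wt v u \<and> Suc (d u) \<le> d v" if v: "v \<in> nonsink" for v
  proof -
    have vV: "v \<in> V" and "v \<noteq> s" using v by (auto simp: nonsink_def)
    then obtain m where m: "d v = Suc m"
      using d[OF vV] by (cases "d v") auto
    then obtain u where u: "(v, u) \<in> E" "(u, s) \<in> E ^^ m"
      using d[OF vV] by (metis relpow_Suc_D2)
    then have "u \<in> V" using E_subset by auto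
    then show ?thesis using u m d_le[OF u(2)] wt_pos_iff[OF vV] by auto
  qed
  define n where "n = Max (d ` V)"
  define D where "D = (\<Sum>v\<in>V. int (outdeg v)) + 1"
  define g where "g v = D ^ (n - d v)" for v
  have D_gt: "int (outdeg v) + 1 \<le> D" if "v \<in> V" for v
    unfolding D_def using finite_V that member_le_sum[of v V "\<lambda>v. int (outdeg v)"] by simp
  have D1: "1 \<le> D" using D_gt[OF sink_in_V] by linarith
  have g1: "1 \<le> g v" for v unfolding g_def using D1 by simp
  have dn: "d v \<le> n" if "v \<in> V" for v
    unfolding n_def using finite_V that by simp
  have ds: "d s = 0" using d_le[of s 0] by simp
  have main: "int (outdeg v) * g v + 1 \<le> (\<Sum>u\<in>V. g u * int (wt v u))" if v: "v \<in> nonsink" for v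
  proof -
    have vV: "v \<in> V" using v by (auto simp: nonsink_def)
    obtain u where u: "u \<in> V" "0 < wt v u" "Suc (d u) \<le> d v" using step[OF v] by blast
    have "int (outdeg v) * g v + 1 \<le> (int (outdeg v) + 1) * g v"
      using g1[of v] by (simp add: algebra_simps)
    also have "\<dots> \<le> D * g v" using D_gt[OF vV] g1[of v] by (intro mult_right_mono) auto
    also have "\<dots> = D ^ Suc (n - d v)" by (simp add: g_def)
    also have "\<dots> \<le> g u"
      unfolding g_def by (rule power_increasing) (use u dn[OF vV] D1 in auto)
    also have "\<dots> \<le> g u * int (wt v u)" using g1[of u] u by simp
    also have "\<dots> \<le> (\<Sum>u\<in>V. g u * int (wt v u))"
      using finite_V u(1) by (intro member_le_sum) (auto simp: g_def D1 order_trans[OF _ D1])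
    finally show ?thesis .
  qed
  show thesis
  proof (rule that[of "\<lambda>v. D ^ n - g v"])
    fix v assume "v \<in> V"
    show "0 \<le> D ^ n - g v"
      unfolding g_def using power_increasing[of "n - d v" n D] D1 by simp
  next
    fix v assume v: "v \<in> nonsink"
    \<comment> \<open>The sink has weight zero, so it may be added to the sum.\<close>
    have "(\<Sum>u\<in>nonsink. (D ^ n - g u) * int (wt v u)) = (\<Sum>u\<in>V. (D ^ n - g u) * int (wt v u))"
      unfolding nonsink_def
      by (rule sum.mono_neutral_left) (use finite_V ds in \<open>auto simp: g_def\<close>)
    also have "\<dots> = D ^ n * int (outdeg v) - (\<Sum>u\<in>V. g u * int (wt v u))"
      by (simp add: left_diff_distrib sum_subtractf outdeg_def sum_distrib_left)
    also have "\<dots> \<le> D ^ n * int (outdeg v) - (int (outdeg v) * g v + 1)"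
      using main[OF v] by simp
    finally show "(\<Sum>u\<in>nonsink. (D ^ n - g u) * int (wt v u)) + 1 \<le> int (outdeg v) * (D ^ n - g v)"
      by (simp add: algebra_simps)
  qed
qed

lemma weighted_sum_reduced_laplacian:
  assumes "\<sigma> \<in> configs" "N \<subseteq> nonsink"
  shows "(\<Sum>u\<in>N. w u * Poly_Mapping.lookup (reduced_laplacian \<sigma>) u) =
    (\<Sum>v\<in>nonsink. Poly_Mapping.lookup \<sigma> v *
       ((if v \<in> N then int (outdeg v) * w v else 0) - (\<Sum>u\<in>N. w u * int (wt v u))))"
proof -
  let ?l = "Poly_Mapping.lookup"
  have "(\<Sum>u\<in>N. w u * ?l (reduced_laplacian \<sigma>) u) =
      (\<Sum>u\<in>N. w u * (int (outdeg u) * ?l \<sigma> u)) - (\<Sum>u\<in>N. \<Sum>v\<in>nonsink. ?l \<sigma> v * (w u * int (wt v u)))"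
    unfolding sum_subtractf[symmetric]
    by (rule sum.cong) (use assms in \<open>auto simp: lookup_reduced_laplacian right_diff_distrib
          sum_distrib_left mult_ac\<close>)
  also have "(\<Sum>u\<in>N. w u * (int (outdeg u) * ?l \<sigma> u)) =
      (\<Sum>v\<in>nonsink. ?l \<sigma> v * (if v \<in> N then int (outdeg v) * w v else 0))"
    by (rule sum.mono_neutral_cong_left) (use assms finite_nonsink in \<open>auto simp: mult_ac\<close>)
  also have "(\<Sum>u\<in>N. \<Sum>v\<in>nonsink. ?l \<sigma> v * (w u * int (wt v u))) =
      (\<Sum>v\<in>nonsink. ?l \<sigma> v * (\<Sum>u\<in>N. w u * int (wt v u)))"
    by (subst sum.swap) (simp add: sum_distrib_left)
  finally show ?thesis by (simp add: sum_subtractf right_diff_distrib)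
qed

text \<open>
  Sum \<open>L \<rho>\<close> with the weights over the vertices where \<open>\<rho>\<close> is negative.  Firing one of these
  vertices loses weight there and firing any other vertex cannot lose any, so every term of the sum
  is at most zero, and it is negative for each vertex of the set.
\<close>

lemma nonneg_if_reduced_laplacian_nonneg:
  assumes "\<rho> \<in> configs" "nonneg (reduced_laplacian \<rho>)"
  shows "nonneg \<rho>"
proof (rule ccontr)
  let ?l = "Poly_Mapping.lookup"
  assume "\<not> nonneg \<rho>"
  define N where "N = {v \<in> nonsink. ?l \<rho> v < 0}"
  obtain v0 where v0: "v0 \<in> nonsink" "?l \<rho> v0 < 0"
    using \<open>\<not> nonneg \<rho>\<close> by (auto simp: nonneg_def not_le)
  have N: "N \<subseteq> nonsink" "finite N" by (auto simp: N_def finite_nonsink)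
  obtain w where w: "\<And>v. v \<in> V \<Longrightarrow> 0 \<le> w v"
    "\<And>v. v \<in> nonsink \<Longrightarrow> (\<Sum>u\<in>nonsink. w u * int (wt v u)) + 1 \<le> int (outdeg v) * w v"
    by (rule decreasing_weight) blast
  have w0: "0 \<le> w u" if "u \<in> nonsink" for u using w(1) that by (auto simp: nonsink_def)
  let ?t = "\<lambda>v. ?l \<rho> v *
       ((if v \<in> N then int (outdeg v) * w v else 0) - (\<Sum>u\<in>N. w u * int (wt v u)))"
  have neg: "?t v < 0" if "v \<in> N" for v
  proof -
    have v: "v \<in> nonsink" "?l \<rho> v < 0" using that by (auto simp: N_def)
    have "(\<Sum>u\<in>N. w u * int (wt v u)) \<le> (\<Sum>u\<in>nonsink. w u * int (wt v u))"
      using N finite_nonsink w0 by (intro sum_mono2) auto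
    then show ?thesis using w(2)[OF v(1)] v(2) that by (intro mult_neg_pos) auto
  qed
  have nonpos: "?t v \<le> 0" if "v \<in> nonsink" for v
  proof (cases "v \<in> N")
    case True
    then show ?thesis using neg[OF True] by simp
  next
    case False
    have "0 \<le> (\<Sum>u\<in>N. w u * int (wt v u))" using N w0 by (intro sum_nonneg) auto
    moreover have "0 \<le> ?l \<rho> v" using False that by (auto simp: N_def)
    ultimately show ?thesis using False by simp
  qed
  have "(\<Sum>v\<in>nonsink. ?t v) < (\<Sum>v\<in>nonsink. 0)"
    using v0 neg nonpos finite_nonsink by (intro sum_strict_mono_ex1) (auto simp: N_def)
  moreover have "0 \<le> (\<Sum>u\<in>N. w u * ?l (reduced_laplacian \<rho>) u)"
    using assms(2) N w0 by (intro sum_nonneg) (auto simp: nonneg_def)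
  ultimately show False
    by (simp add: weighted_sum_reduced_laplacian[OF assms(1) N(1)])
qed

text \<open>
  A script cannot be longer than the weight it destroys, so among the scripts that keep a given
  nonnegative configuration nonnegative there is a longest one.  It stabilizes the configuration,
  since an unstable vertex could be fired once more.
\<close>

lemma stabilizing_script:
  assumes "x \<in> configs" "nonneg x"
  obtains \<tau> where "\<tau> \<in> configs" "nonneg \<tau>" "stable (x - reduced_laplacian \<tau>)"
proof -
  let ?l = "Poly_Mapping.lookup"
  obtain w where w: "\<And>v. v \<in> V \<Longrightarrow> 0 \<le> w v"
    "\<And>v. v \<in> nonsink \<Longrightarrow> (\<Sum>u\<in>nonsink. w u * int (wt v u)) + 1 \<le> int (outdeg v) * w v"
    by (rule decreasing_weight) blast
  define size where "size \<tau> = (\<Sum>v\<in>nonsink. ?l \<tau> v)" for \<tau> :: "'v \<Rightarrow>\<^sub>0 int"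
  define P where "P \<tau> \<longleftrightarrow> \<tau> \<in> configs \<and> nonneg \<tau> \<and> nonneg (x - reduced_laplacian \<tau>)" for \<tau>
  define B where "B = (\<Sum>u\<in>nonsink. w u * ?l x u)"
  have bound: "nat (size \<tau>) < Suc (nat B)" if "P \<tau>" for \<tau>
  proof -
    have \<tau>: "\<tau> \<in> configs" "nonneg \<tau>" "nonneg (x - reduced_laplacian \<tau>)"
      using that by (auto simp: P_def)
    have "size \<tau> \<le> (\<Sum>v\<in>nonsink. ?l \<tau> v *
       ((if v \<in> nonsink then int (outdeg v) * w v else 0) - (\<Sum>u\<in>nonsink. w u * int (wt v u))))"
      unfolding size_def
    proof (rule sum_mono)
      fix v assume v: "v \<in> nonsink"
      have "?l \<tau> v * 1 \<le> ?l \<tau> v *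
          (int (outdeg v) * w v - (\<Sum>u\<in>nonsink. w u * int (wt v u)))"
        using w(2)[OF v] \<tau>(2) v by (intro mult_left_mono) (auto simp: nonneg_def)
      then show "?l \<tau> v \<le> ?l \<tau> v *
       ((if v \<in> nonsink then int (outdeg v) * w v else 0) - (\<Sum>u\<in>nonsink. w u * int (wt v u)))"
        using v by simp
    qed
    also have "\<dots> = (\<Sum>u\<in>nonsink. w u * ?l (reduced_laplacian \<tau>) u)"
      by (simp only: weighted_sum_reduced_laplacian[OF \<tau>(1) order_refl])
    also have "\<dots> \<le> B"
      unfolding B_def using \<tau>(3) w(1)
      by (intro sum_mono mult_left_mono) (auto simp: nonneg_def lookup_minus nonsink_def)
    finally show ?thesis by linarith
  qed
  have "P 0" using assms by (auto simp: P_def configs_0 nonneg_def reduced_laplacian_0)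
  then obtain \<tau> where \<tau>: "P \<tau>" and max: "\<And>\<rho>. P \<rho> \<Longrightarrow> nat (size \<rho>) \<le> nat (size \<tau>)"
    using ex_has_greatest_nat[of P 0 "\<lambda>\<tau>. nat (size \<tau>)" "Suc (nat B)"] bound by (metis nat_less_le)
  have \<tau>': "\<tau> \<in> configs" "nonneg \<tau>" "nonneg (x - reduced_laplacian \<tau>)"
    using \<tau> by (auto simp: P_def)
  have "stable (x - reduced_laplacian \<tau>)"
  proof (rule ccontr)
    assume "\<not> stable (x - reduced_laplacian \<tau>)"
    then obtain v where v: "v \<in> nonsink"
      "int (outdeg v) \<le> ?l (x - reduced_laplacian \<tau>) v"
      by (auto simp: stable_def not_less)
    have "nonneg (x - reduced_laplacian (\<tau> + frag_of v))"
      using nonneg_fire[OF \<tau>'(3) v] by (simp add: reduced_laplacian_add diff_diff_eq)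
    then have "P (\<tau> + frag_of v)"
      using \<tau>' v(1) by (auto simp: P_def configs_add configs_frag_of nonneg_def lookup_add)
    moreover have "size (\<tau> + frag_of v) = size \<tau> + 1"
      using v(1) finite_nonsink by (simp add: size_def lookup_add sum.distrib)
    moreover have "0 \<le> size \<tau>"
      unfolding size_def using \<tau>'(2) by (intro sum_nonneg) (auto simp: nonneg_def)
    ultimately show False using max by fastforce
  qed
  then show thesis using that \<tau>' by blast
qed

text \<open>
  To dominate \<open>a\<close>, stabilize a configuration above \<open>a + c_max\<close>: what remains is at most
  \<open>c_max\<close>, so the Laplacian of the script has taken away at least \<open>a\<close>.
\<close>

lemma dominating_script:
  obtains \<tau> where "\<tau> \<in> configs" "nonneg \<tau>" "nonneg (reduced_laplacian \<tau> - a)"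
proof -
  let ?l = "Poly_Mapping.lookup"
  define x where "x = (\<Sum>v\<in>nonsink. frag_cmul (\<bar>?l a v\<bar> + int (outdeg v)) (frag_of v))"
  have x: "?l x v = \<bar>?l a v\<bar> + int (outdeg v)" if "v \<in> nonsink" for v
    using that by (simp add: x_def lookup_sum_frag_of)
  have "x \<in> configs" by (simp add: x_def configs_sum_frag_of)
  moreover have "nonneg x" by (simp add: nonneg_def x)
  ultimately obtain \<tau> where \<tau>: "\<tau> \<in> configs" "nonneg \<tau>" "stable (x - reduced_laplacian \<tau>)"
    by (rule stabilizing_script)
  have "nonneg (reduced_laplacian \<tau> - a)"
    unfolding nonneg_def
  proof
    fix v assume v: "v \<in> nonsink"
    then have "?l x v - ?l (reduced_laplacian \<tau>) v < int (outdeg v)"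
      using \<tau>(3) by (auto simp: stable_def lookup_minus)
    then show "0 \<le> ?l (reduced_laplacian \<tau> - a) v"
      using x[OF v] by (simp add: lookup_minus)
  qed
  then show thesis using that \<tau> by blast
qed

section \<open>Least action and greedy firing\<close>

text \<open>
  If the legal script had already used up the share of \<open>v\<close> in \<open>\<rho>\<close> and \<open>v\<close> were unstable, the rest of
  \<open>\<rho>\<close> could not make \<open>v\<close> lose grains, and \<open>\<rho>\<close> would leave it unstable.  So each legal
  firing stays within \<open>\<rho>\<close>.
\<close>

lemma least_action:
  assumes "leads_to x y"
  obtains \<tau> where "\<tau> \<in> configs" "y = x - reduced_laplacian \<tau>"
    "\<And>\<rho>. \<rho> \<in> configs \<Longrightarrow> nonneg \<rho> \<Longrightarrow> stable (x - reduced_laplacian \<rho>) \<Longrightarrow> nonneg (\<rho> - \<tau>)"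
proof -
  let ?l = "Poly_Mapping.lookup"
  have "legal_firing\<^sup>*\<^sup>* x y" using assms by (simp add: leads_to_def)
  then have "\<exists>\<tau>\<in>configs. y = x - reduced_laplacian \<tau> \<and>
    (\<forall>\<rho>\<in>configs. nonneg \<rho> \<longrightarrow> stable (x - reduced_laplacian \<rho>) \<longrightarrow> nonneg (\<rho> - \<tau>))"
  proof (induction rule: rtranclp_induct)
    case base
    show ?case by (rule bexI[of _ 0]) (auto simp: reduced_laplacian_0 configs_0)
  next
    case (step y z)
    then obtain \<tau> where \<tau>: "\<tau> \<in> configs" "y = x - reduced_laplacian \<tau>"
      "\<And>\<rho>. \<rho> \<in> configs \<Longrightarrow> nonneg \<rho> \<Longrightarrow> stable (x - reduced_laplacian \<rho>) \<Longrightarrow> nonneg (\<rho> - \<tau>)"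
      by blast
    obtain v where v: "v \<in> nonsink" "int (outdeg v) \<le> ?l y v"
      and z: "z = y - reduced_laplacian (frag_of v)"
      using step.hyps(2) by (auto simp: legal_firing_def)
    have "nonneg (\<rho> - (\<tau> + frag_of v))"
      if \<rho>: "\<rho> \<in> configs" "nonneg \<rho>" "stable (x - reduced_laplacian \<rho>)" for \<rho>
    proof -
      have nn: "nonneg (\<rho> - \<tau>)" using \<tau>(3) \<rho> by blast
      have "?l (\<rho> - \<tau>) v \<noteq> 0"
      proof
        assume "?l (\<rho> - \<tau>) v = 0"
        then have "?l (reduced_laplacian (\<rho> - \<tau>)) v \<le> 0"
          using \<rho>(1) \<tau>(1) nn v(1)
          by (intro reduced_laplacian_nonpos_at_unfired) (auto intro: configs_diff)
        then have "int (outdeg v) \<le> ?l (x - reduced_laplacian \<rho>) v"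
          using v(2) \<tau>(2) by (simp add: reduced_laplacian_diff lookup_minus)
        then show False using \<rho>(3) v(1) by (auto simp: stable_def)
      qed
      moreover have "0 \<le> ?l (\<rho> - \<tau>) v" using nn v(1) by (auto simp: nonneg_def)
      ultimately show ?thesis
        using nn by (auto simp: nonneg_def lookup_minus lookup_add)
    qed
    then show ?case
      using \<tau>(1,2) v(1) z
      by (intro bexI[of _ "\<tau> + frag_of v"])
        (auto simp: reduced_laplacian_add diff_diff_eq configs_add configs_frag_of)
  qed
  then show thesis using that by blast
qed

text \<open>
  Superstability says that, for \<open>\<tau> \<noteq> 0\<close>, some vertex is unstable; as \<open>c_max - c\<close> is stable, that
  vertex occurs in \<open>\<tau>\<close>, so firing it shortens the script that remains to be fired.
\<close>

lemma superstable_dual_reached: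
  assumes "superstable c" "\<tau> \<in> configs" "nonneg \<tau>"
  shows "leads_to (c_max - c + reduced_laplacian \<tau>) (c_max - c)"
  using assms(2,3)
proof (induction "nat (\<Sum>v\<in>nonsink. Poly_Mapping.lookup \<tau> v)" arbitrary: \<tau> rule: less_induct)
  case (less \<tau>)
  let ?l = "Poly_Mapping.lookup"
  show ?case
  proof (cases "\<tau> = 0")
    case True
    then show ?thesis by (simp add: reduced_laplacian_0 leads_to_def)
  next
    case False
    then have "\<not> nonneg (c - reduced_laplacian \<tau>)"
      using assms(1) less.prems by (auto simp: superstable_def)
    then have "\<not> stable (c_max - (c - reduced_laplacian \<tau>))"
      by (simp add: stable_iff_nonneg_dual)
    then obtain v where v: "v \<in> nonsink"
      "int (outdeg v) \<le> ?l (c_max - c + reduced_laplacian \<tau>) v"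
      by (auto simp: stable_def not_less algebra_simps)
    have "stable (c_max - c)"
      using assms(1) by (simp add: stable_iff_nonneg_dual superstable_def)
    then have "0 < ?l (reduced_laplacian \<tau>) v"
      using v by (auto simp: stable_def lookup_add)
    then have "?l \<tau> v \<noteq> 0"
      using reduced_laplacian_nonpos_at_unfired[OF less.prems v(1)] by linarith
    moreover have "0 \<le> ?l \<tau> v" using less.prems(2) v(1) by (auto simp: nonneg_def)
    ultimately have pos: "1 \<le> ?l \<tau> v" by linarith
    let ?\<rho> = "\<tau> - frag_of v"
    have \<rho>: "?\<rho> \<in> configs" "nonneg ?\<rho>"
      using less.prems v(1) pos by (auto simp: configs_diff configs_frag_of nonneg_def lookup_minus)
    have "(\<Sum>u\<in>nonsink. ?l \<tau> u) = (\<Sum>u\<in>nonsink. ?l ?\<rho> u) + 1"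
      using v(1) finite_nonsink by (simp add: lookup_minus sum_subtractf)
    moreover have "0 \<le> (\<Sum>u\<in>nonsink. ?l ?\<rho> u)"
      using \<rho>(2) by (intro sum_nonneg) (auto simp: nonneg_def)
    ultimately have "leads_to (c_max - c + reduced_laplacian ?\<rho>) (c_max - c)"
      using \<rho> by (intro less.hyps) auto
    moreover have "legal_firing (c_max - c + reduced_laplacian \<tau>) (c_max - c + reduced_laplacian ?\<rho>)"
      unfolding legal_firing_def
      by (rule bexI[OF _ v(1)]) (use v(2) in \<open>simp add: reduced_laplacian_diff algebra_simps\<close>)
    ultimately show ?thesis
      unfolding leads_to_def by (rule converse_rtranclp_into_rtranclp[rotated])
  qed
qed

section \<open>Superstable and recurrent configurations\<close>

lemma superstable_imp_stable:
  assumes "superstable c"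
  shows "stable c"
proof (rule ccontr)
  assume "\<not> stable c"
  then obtain v where v: "v \<in> nonsink" "int (outdeg v) \<le> Poly_Mapping.lookup c v"
    by (auto simp: stable_def not_less)
  have "nonneg (c - reduced_laplacian (frag_of v))"
    using assms v by (intro nonneg_fire) (auto simp: superstable_def)
  moreover have "nonneg (frag_of v)" by (auto simp: nonneg_def)
  ultimately show False
    using assms v(1) configs_frag_of[OF v(1)] by (auto simp: superstable_def frag_of_nonzero)
qed

lemma recurrent_dual_if_superstable:
  assumes "c \<in> configs" "superstable c"
  shows "recurrent (c_max - c)"
proof -
  have "nonneg (c_max - c)"
    using superstable_imp_stable[OF assms(2)]
    by (auto simp: nonneg_def stable_def lookup_minus lookup_c_max)
  moreover have "stable (c_max - c)"
    using assms(2) by (simp add: stable_iff_nonneg_dual superstable_def)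
  moreover have "accessible (c_max - c)"
    unfolding accessible_def
  proof
    fix a assume a: "a \<in> configs"
    obtain \<tau> where \<tau>: "\<tau> \<in> configs" "nonneg \<tau>" "nonneg (reduced_laplacian \<tau> - (a - (c_max - c)))"
      by (rule dominating_script)
    let ?b = "reduced_laplacian \<tau> - (a - (c_max - c))"
    have "?b \<in> configs"
      using \<tau>(1) a assms(1) by (intro configs_diff configs_reduced_laplacian configs_c_max)
    moreover have "leads_to (a + ?b) (c_max - c)"
      using superstable_dual_reached[OF assms(2) \<tau>(1,2)] by (simp add: algebra_simps)
    ultimately show "\<exists>b\<in>configs. nonneg b \<and> leads_to (a + b) (c_max - c)"
      using \<tau>(3) by blast
  qed
  ultimately show ?thesis by (simp add: recurrent_def)
qed

lemma superstable_if_recurrent_dual: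
  assumes "recurrent (c_max - c)"
  shows "superstable c"
proof -
  let ?l = "Poly_Mapping.lookup"
  have nn: "nonneg c"
    using assms by (simp add: recurrent_def flip: stable_iff_nonneg_dual)
  have "\<sigma> = 0" if \<sigma>: "\<sigma> \<in> configs" "nonneg \<sigma>" "nonneg (c - reduced_laplacian \<sigma>)" for \<sigma>
  proof -
    \<comment> \<open>Starting above \<open>c_max + L \<sigma>\<close> forces every script that ends in a stable configuration to
        contain \<open>\<sigma>\<close>.\<close>
    have "c_max + reduced_laplacian \<sigma> \<in> configs"
      using \<sigma>(1) by (intro configs_add configs_c_max configs_reduced_laplacian)
    then obtain b where b: "b \<in> configs" "nonneg b"
      "leads_to (c_max + reduced_laplacian \<sigma> + b) (c_max - c)"
      using assms by (auto simp: recurrent_def accessible_def)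
    let ?x = "c_max + reduced_laplacian \<sigma> + b"
    obtain \<tau> where \<tau>: "\<tau> \<in> configs" "c_max - c = ?x - reduced_laplacian \<tau>"
      "\<And>\<rho>. \<rho> \<in> configs \<Longrightarrow> nonneg \<rho> \<Longrightarrow> stable (?x - reduced_laplacian \<rho>) \<Longrightarrow> nonneg (\<rho> - \<tau>)"
      using least_action[OF b(3)] by blast
    have "reduced_laplacian (\<tau> - \<sigma>) = c + b"
      using \<tau>(2) by (simp add: reduced_laplacian_diff algebra_simps)
    then have "nonneg (reduced_laplacian (\<tau> - \<sigma>))"
      using nn b(2) by (auto simp: nonneg_def lookup_add)
    then have "nonneg (\<tau> - \<sigma>)"
      by (rule nonneg_if_reduced_laplacian_nonneg[OF configs_diff[OF \<tau>(1) \<sigma>(1)]])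
    moreover have "?x - reduced_laplacian (\<tau> - \<sigma>) = c_max - (c - reduced_laplacian \<sigma>)"
      using \<tau>(2) by (simp add: reduced_laplacian_diff algebra_simps)
    then have "stable (?x - reduced_laplacian (\<tau> - \<sigma>))"
      using \<sigma>(3) by (simp only: stable_iff_nonneg_dual)
    ultimately have "nonneg (\<tau> - \<sigma> - \<tau>)"
      by (rule \<tau>(3)[OF configs_diff[OF \<tau>(1) \<sigma>(1)]])
    then have "\<forall>v\<in>nonsink. ?l \<sigma> v = 0"
      using \<sigma>(2) by (force simp: nonneg_def lookup_minus)
    then show "\<sigma> = 0" using configs_eq_0_iff[OF \<sigma>(1)] by blast
  qed
  then show ?thesis using nn by (auto simp: superstable_def)
qed

end

theorem corollary5p15:
  fixes V :: "'v set" and E :: "('v \<times> 'v) set" and wt :: "'v \<Rightarrow> 'v \<Rightarrow> nat" and s :: 'v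
    and c :: "'v \<Rightarrow>\<^sub>0 int"
  assumes "sandpile_graph V E wt s"
    and "c \<in> sandpile_graph.configs V s"
  shows "sandpile_graph.superstable V wt s c \<longleftrightarrow>
         sandpile_graph.recurrent V wt s (sandpile_graph.c_max V wt s - c)"
  using sandpile_graph.recurrent_dual_if_superstable[OF assms]
    sandpile_graph.superstable_if_recurrent_dual[OF assms(1)] by blast

end
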